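(* Let $\mathcal{L}$ be a finite bounded lattice with least element $\hat 0$ and greatest element $\hat 1$, let $x \in \mathcal{L}\setminus\{\hat 0,\hat 1\}$, and let $P = \mathcal{L}\setminus \mathrm{Co}_{\mathcal{L}}(x)$, where $\mathrm{Co}_{\mathcal{L}}(x)=\{y\in\mathcal{L} : x\wedge y=\hat 0 \text{ and } x\vee y=\hat 1\}$ is the set of complements of $x$. Let $\bar P = P\setminus\{\hat 0,\hat 1\}$. Then the order complex $\Delta(\bar P)$ is nonevasive; in particular it is collapsible.
   Context: For a finite poset $Q$, the order complex $\Delta(Q)$ is the abstract simplicial complex on vertex set $Q$ whose faces are the chains (totally ordered subsets) of $Q$. For a simplicial complex $\Delta$ and a vertex $v$, the deletion $\mathrm{dl}_\Delta(v)$ is the subcomplex of faces not containing $v$, and the link $\mathrm{lk}_\Delta(v)$ is the set of faces $\sigma$ with $v\notin\sigma$ and $\sigma\cup\{v\}\in\Delta$. A simplicial complex $\Delta$ on a finite vertex set is nonevasive if either it consists of a single vertex, or there exists a vertex $v$ such that both $\mathrm{dl}_\Delta(v)$ and $\mathrm{lk}_\Delta(v)$ are nonevasive. A simplicial complex is collapsible if it can be reduced to a single point by a sequence of elementary collapses, where an elementary collapse removes a pair of faces $\sigma\subsetneq\tau$ such that $\sigma$ is a proper face of exactly one face, namely $\tau$. *)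

theory Defs
  imports Main
begin

text \<open>
  A simplicial complex is represented by its set of faces, the empty face included; its vertices
  are the \<open>v\<close> for which \<open>{v}\<close> is a face.  In particular the complex consisting of the single
  vertex \<open>v\<close> is \<open>{{}, {v}}\<close>.
\<close>

definition simplicial_complex :: "'a set set \<Rightarrow> bool" where
  "simplicial_complex \<Delta> \<longleftrightarrow>
     {} \<in> \<Delta> \<and> (\<forall>\<sigma>\<in>\<Delta>. finite \<sigma>) \<and> (\<forall>\<sigma>\<in>\<Delta>. \<forall>\<rho>. \<rho> \<subseteq> \<sigma> \<longrightarrow> \<rho> \<in> \<Delta>)"

definition order_complex :: "'a::order set \<Rightarrow> 'a set set" where
  "order_complex Q = {C. C \<subseteq> Q \<and> Complete_Partial_Order.chain (\<le>) C}"

definition deletion :: "'a set set \<Rightarrow> 'a \<Rightarrow> 'a set set" where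
  "deletion \<Delta> v = {\<sigma> \<in> \<Delta>. v \<notin> \<sigma>}"

definition link :: "'a set set \<Rightarrow> 'a \<Rightarrow> 'a set set" where
  "link \<Delta> v = {\<sigma>. v \<notin> \<sigma> \<and> insert v \<sigma> \<in> \<Delta>}"

inductive nonevasive :: "'a set set \<Rightarrow> bool" where
  vertex: "nonevasive {{}, {v}}"
| step: "{v} \<in> \<Delta> \<Longrightarrow> nonevasive (deletion \<Delta> v) \<Longrightarrow> nonevasive (link \<Delta> v) \<Longrightarrow> nonevasive \<Delta>"

text \<open>
  In a simplicial complex the condition forces \<open>card \<tau> = card \<sigma> + 1\<close>.  The choice \<open>\<sigma> = {}\<close> is
  possible only in a single vertex and leads to the complex without faces, so it has no effect on
  collapsibility.
\<close>

definition elementary_collapse :: "'a set set \<Rightarrow> 'a set set \<Rightarrow> bool" where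
  "elementary_collapse \<Delta> \<Delta>' \<longleftrightarrow>
     (\<exists>\<sigma>\<in>\<Delta>. \<exists>\<tau>\<in>\<Delta>. \<sigma> \<subset> \<tau> \<and> (\<forall>\<rho>\<in>\<Delta>. \<sigma> \<subset> \<rho> \<longrightarrow> \<rho> = \<tau>) \<and> \<Delta>' = \<Delta> - {\<sigma>, \<tau>})"

definition collapsible :: "'a set set \<Rightarrow> bool" where
  "collapsible \<Delta> \<longleftrightarrow> (\<exists>v. elementary_collapse\<^sup>*\<^sup>* \<Delta> {{}, {v}})"

definition complements :: "'a::bounded_lattice \<Rightarrow> 'a set" where
  "complements x = {y. inf x y = bot \<and> sup x y = top}"

lemma simplicial_complex_order_complex:
  assumes "finite Q"
  shows "simplicial_complex (order_complex Q)"
  using assms by (auto simp: simplicial_complex_def order_complex_def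
      Complete_Partial_Order.chain_def intro: finite_subset)

lemma singleton_in_order_complex_iff: "{v} \<in> order_complex Q \<longleftrightarrow> v \<in> Q"
  by (simp add: order_complex_def Complete_Partial_Order.chain_def)

lemma simplicial_complex_deletion:
  assumes "simplicial_complex \<Delta>"
  shows "simplicial_complex (deletion \<Delta> v)"
  using assms unfolding simplicial_complex_def deletion_def by blast

lemma simplicial_complex_link:
  assumes "simplicial_complex \<Delta>" and "{v} \<in> \<Delta>"
  shows "simplicial_complex (link \<Delta> v)"
proof -
  have "insert v \<rho> \<in> \<Delta>" if "insert v \<sigma> \<in> \<Delta>" "\<rho> \<subseteq> \<sigma>" for \<sigma> \<rho>
    using assms(1) that unfolding simplicial_complex_def by (meson insert_mono)
  moreover have "finite \<sigma>" if "insert v \<sigma> \<in> \<Delta>" for \<sigma>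
    using assms(1) that unfolding simplicial_complex_def by (meson finite_insert)
  ultimately show ?thesis
    using assms(2) unfolding simplicial_complex_def link_def by blast
qed

lemma simplicial_complex_elementary_collapse:
  assumes "simplicial_complex \<Delta>" and "elementary_collapse \<Delta> \<Delta>'" and "\<Delta>' \<noteq> {}"
  shows "simplicial_complex \<Delta>'"
proof -
  from assms(2) obtain \<sigma> \<tau> where st: "\<sigma> \<in> \<Delta>" "\<tau> \<in> \<Delta>" "\<sigma> \<subset> \<tau>"
    and free: "\<And>\<rho>. \<rho> \<in> \<Delta> \<Longrightarrow> \<sigma> \<subset> \<rho> \<Longrightarrow> \<rho> = \<tau>" and eq: "\<Delta>' = \<Delta> - {\<sigma>, \<tau>}"
    unfolding elementary_collapse_def by blast
  have down: "\<rho> \<in> \<Delta>'" if "\<mu> \<in> \<Delta>'" "\<rho> \<subseteq> \<mu>" for \<mu> \<rho>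
  proof -
    have "\<mu> \<in> \<Delta>" "\<mu> \<noteq> \<sigma>" "\<mu> \<noteq> \<tau>" using that(1) eq by auto
    moreover from this have "\<rho> \<in> \<Delta>"
      using assms(1) that(2) unfolding simplicial_complex_def by blast
    moreover have "\<not> \<sigma> \<subseteq> \<mu>" using free[of \<mu>] calculation by blast
    ultimately show ?thesis using st(3) that(2) eq by blast
  qed
  moreover have "{} \<in> \<Delta>'" using assms(3) down by blast
  moreover have "\<forall>\<mu>\<in>\<Delta>'. finite \<mu>"
    using assms(1) eq unfolding simplicial_complex_def by blast
  ultimately show ?thesis unfolding simplicial_complex_def by blast
qed

end

theory Submission
  imports Defs
begin

text \<open>
  We work in an interval of a lattice with ends \<open>a < b\<close>.  For \<open>y\<close> in it with \<open>\<not> x \<le> y\<close> and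
  \<open>w = x \<squnion> y < b\<close>, let \<open>A\<^sub>y\<close> be the set of all \<open>z\<close> strictly between \<open>y\<close> and \<open>b\<close> with
  \<open>x \<sqinter> z \<noteq> x \<sqinter> y\<close>.  It is stable under the interior operator \<open>z \<mapsto> z \<sqinter> w\<close>, whose fixed points
  have the greatest element \<open>w\<close>, so \<open>A\<^sub>y\<close> is nonevasive.  The noncomplements of \<open>x\<close> outside \<open>A\<^sub>a\<close>
  are such elements \<open>y\<close> with \<open>x \<sqinter> y = a\<close>.  Removing them, maximal ones first, leaves exactly
  \<open>A\<^sub>y\<close> above each removed \<open>y\<close>, and ends in \<open>A\<^sub>a\<close>.
\<close>

lemma elementary_collapseI:
  assumes "\<sigma> \<in> \<Delta>" and "\<tau> \<in> \<Delta>" and "\<sigma> \<subset> \<tau>"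
    and "\<And>\<rho>. \<rho> \<in> \<Delta> \<Longrightarrow> \<sigma> \<subset> \<rho> \<Longrightarrow> \<rho> = \<tau>"
  shows "elementary_collapse \<Delta> (\<Delta> - {\<sigma>, \<tau>})"
  using assms unfolding elementary_collapse_def by blast

lemma elementary_collapse_subset: "elementary_collapse \<Delta> \<Delta>' \<Longrightarrow> \<Delta>' \<subseteq> \<Delta>"
  unfolding elementary_collapse_def by blast

lemma rtranclp_elementary_collapse_subset: "elementary_collapse\<^sup>*\<^sup>* \<Delta> \<Delta>' \<Longrightarrow> \<Delta>' \<subseteq> \<Delta>"
  by (induction rule: rtranclp_induct) (auto dest: elementary_collapse_subset)

lemma elementary_collapse_Un_cone:
  assumes "elementary_collapse \<Lambda> \<Lambda>'" and "v \<notin> \<Union> \<Lambda>" and "v \<notin> \<Union> D"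
  shows "elementary_collapse (D \<union> insert v ` \<Lambda>) (D \<union> insert v ` \<Lambda>')"
proof -
  let ?E = "D \<union> insert v ` \<Lambda>"
  from assms(1) obtain \<sigma> \<tau> where faces: "\<sigma> \<in> \<Lambda>" "\<tau> \<in> \<Lambda>" "\<sigma> \<subset> \<tau>"
    and free: "\<And>\<rho>. \<rho> \<in> \<Lambda> \<Longrightarrow> \<sigma> \<subset> \<rho> \<Longrightarrow> \<rho> = \<tau>" and reduced: "\<Lambda>' = \<Lambda> - {\<sigma>, \<tau>}"
    unfolding elementary_collapse_def by blast
  have insert_psubset_iff: "insert v \<mu> \<subset> insert v \<nu> \<longleftrightarrow> \<mu> \<subset> \<nu>"
    if "\<mu> \<in> \<Lambda>" "\<nu> \<in> \<Lambda>" for \<mu> \<nu>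
  proof -
    have "v \<notin> \<mu>" and "v \<notin> \<nu>" using that assms(2) by blast+
    then show ?thesis by (simp add: psubset_eq insert_ident subset_insert)
  qed
  have "inj_on (insert v) \<Lambda>"
    using assms(2) by (intro inj_onI) (metis UnionI insert_ident)
  then have "insert v ` \<Lambda>' = insert v ` \<Lambda> - {insert v \<sigma>, insert v \<tau>}"
    using faces by (simp add: reduced inj_on_image_set_diff[where C = \<Lambda>])
  then have result: "D \<union> insert v ` \<Lambda>' = ?E - {insert v \<sigma>, insert v \<tau>}"
    using assms(3) by blast
  show ?thesis
    unfolding result
  proof (rule elementary_collapseI)
    show "insert v \<sigma> \<in> ?E" "insert v \<tau> \<in> ?E" using faces by blast+
    show "insert v \<sigma> \<subset> insert v \<tau>" using faces by (simp add: insert_psubset_iff)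
    fix \<rho> assume "\<rho> \<in> ?E" and "insert v \<sigma> \<subset> \<rho>"
    moreover from this obtain \<nu> where "\<nu> \<in> \<Lambda>" and "\<rho> = insert v \<nu>"
      using assms(3) by blast
    ultimately show "\<rho> = insert v \<tau>" using free[of \<nu>] faces(1) by (simp add: insert_psubset_iff)
  qed
qed

lemma rtranclp_elementary_collapse_Un_cone:
  assumes "elementary_collapse\<^sup>*\<^sup>* \<Lambda> \<Lambda>'" and "v \<notin> \<Union> \<Lambda>" and "v \<notin> \<Union> D"
  shows "elementary_collapse\<^sup>*\<^sup>* (D \<union> insert v ` \<Lambda>) (D \<union> insert v ` \<Lambda>')"
  using assms(1)
proof (induction rule: rtranclp_induct)
  case base
  show ?case by simp
next
  case (step \<Lambda>1 \<Lambda>2)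
  have "v \<notin> \<Union> \<Lambda>1"
    using assms(2) rtranclp_elementary_collapse_subset[OF step.hyps(1)] by blast
  then show ?case
    using step assms(3) by (meson elementary_collapse_Un_cone rtranclp.rtrancl_into_rtrancl)
qed

lemma deletion_Un_cone_link: "deletion \<Delta> v \<union> insert v ` link \<Delta> v = \<Delta>"
proof -
  have "\<sigma> \<in> insert v ` link \<Delta> v" if "\<sigma> \<in> \<Delta>" "v \<in> \<sigma>" for \<sigma>
    using that by (intro image_eqI[of _ _ "\<sigma> - {v}"]) (auto simp: link_def insert_absorb)
  then show ?thesis
    by (auto simp: deletion_def link_def)
qed

lemma collapsible_link_imp_collapses_to_deletion:
  assumes "collapsible (link \<Delta> v)"
  shows "elementary_collapse\<^sup>*\<^sup>* \<Delta> (deletion \<Delta> v)"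
proof -
  let ?D = "deletion \<Delta> v"
  have notin_link: "v \<notin> \<Union> (link \<Delta> v)" and notin_deletion: "v \<notin> \<Union> ?D"
    by (auto simp: deletion_def link_def)
  obtain w where w: "elementary_collapse\<^sup>*\<^sup>* (link \<Delta> v) {{}, {w}}"
    using assms unfolding collapsible_def by blast
  let ?E = "?D \<union> {{v}, {v, w}}"
  have "elementary_collapse\<^sup>*\<^sup>* \<Delta> ?E"
    using rtranclp_elementary_collapse_Un_cone[OF w notin_link notin_deletion]
    by (simp add: deletion_Un_cone_link)
  moreover have "elementary_collapse ?E (?E - {{v}, {v, w}})"
  proof (rule elementary_collapseI)
    have "w \<noteq> v"
      using rtranclp_elementary_collapse_subset[OF w] notin_link by blast
    then show "{v} \<subset> {v, w}" by blast
    show "\<rho> = {v, w}" if "\<rho> \<in> ?E" "{v} \<subset> \<rho>" for \<rho>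
      using that notin_deletion by blast
  qed simp_all
  moreover have "?E - {{v}, {v, w}} = ?D"
    using notin_deletion by blast
  ultimately show ?thesis by simp
qed

lemma nonevasive_imp_collapsible:
  assumes "nonevasive \<Delta>"
  shows "collapsible \<Delta>"
  using assms
proof induction
  case (vertex v)
  show ?case unfolding collapsible_def by blast
next
  case (step v \<Delta>)
  then have "elementary_collapse\<^sup>*\<^sup>* \<Delta> (deletion \<Delta> v)"
    by (intro collapsible_link_imp_collapses_to_deletion)
  then show ?case
    using step.IH(1) unfolding collapsible_def by (meson rtranclp_trans)
qed

lemma order_complex_singleton: "order_complex {a} = {{}, {a}}"
  by (auto simp: order_complex_def Complete_Partial_Order.chain_def subset_singleton_iff)

lemma deletion_order_complex: "deletion (order_complex Q) v = order_complex (Q - {v})"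
  by (auto simp: order_complex_def deletion_def)

lemma link_order_complex:
  assumes "v \<in> Q"
  shows "link (order_complex Q) v = order_complex (Q \<inter> ({..<v} \<union> {v<..}))"
proof -
  have "v \<notin> \<sigma> \<and> Complete_Partial_Order.chain (\<le>) (insert v \<sigma>) \<longleftrightarrow>
      \<sigma> \<subseteq> {..<v} \<union> {v<..} \<and> Complete_Partial_Order.chain (\<le>) \<sigma>" for \<sigma>
    unfolding Complete_Partial_Order.chain_def by (fastforce simp: less_le)
  then show ?thesis
    using assms unfolding order_complex_def link_def by blast
qed

lemma nonevasive_order_complex_step:
  assumes "v \<in> Q" and "nonevasive (order_complex (Q - {v}))"
    and "nonevasive (order_complex (Q \<inter> ({..<v} \<union> {v<..})))"
  shows "nonevasive (order_complex Q)"
  using assms nonevasive.step[of v "order_complex Q"]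
  by (simp add: singleton_in_order_complex_iff deletion_order_complex link_order_complex)

lemma nonevasive_order_complex_join:
  assumes "finite L" and "nonevasive (order_complex U)"
    and "\<And>l u. l \<in> L \<Longrightarrow> u \<in> U \<Longrightarrow> l < u \<or> u < l"
  shows "nonevasive (order_complex (L \<union> U))"
  using assms(1,3)
proof (induction L rule: finite_psubset_induct)
  case (psubset L)
  show ?case
  proof (cases "L = {}")
    case True
    then show ?thesis using assms(2) by simp
  next
    case False
    then obtain v where v: "v \<in> L" by blast
    then have "v \<notin> U" and U: "U \<subseteq> {..<v} \<union> {v<..}"
      using psubset.prems by blast+
    then have deletion_eq: "L \<union> U - {v} = (L - {v}) \<union> U" by blast
    have link_eq: "(L \<union> U) \<inter> ({..<v} \<union> {v<..}) = (L \<inter> ({..<v} \<union> {v<..})) \<union> U"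
      using U by blast
    show ?thesis
    proof (rule nonevasive_order_complex_step[of v])
      show "v \<in> L \<union> U" using v by blast
      show "nonevasive (order_complex (L \<union> U - {v}))"
        unfolding deletion_eq using v psubset.prems by (intro psubset.IH) blast+
      have "v \<notin> {..<v} \<union> {v<..}" by simp
      then show "nonevasive (order_complex ((L \<union> U) \<inter> ({..<v} \<union> {v<..})))"
        unfolding link_eq using v psubset.prems by (intro psubset.IH) blast+
    qed
  qed
qed

lemma nonevasive_order_complex_cone:
  assumes "finite Q" and "a \<in> Q" and "\<And>u. u \<in> Q \<Longrightarrow> u \<le> a \<or> a \<le> u"
  shows "nonevasive (order_complex Q)"
proof -
  have "nonevasive (order_complex ((Q - {a}) \<union> {a}))"
    using assms by (intro nonevasive_order_complex_join)
      (auto simp: order_complex_singleton nonevasive.vertex less_le)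
  then show ?thesis using assms(2) by (simp add: insert_absorb)
qed

text \<open>The link of \<open>v\<close> is the join of the parts below and above \<open>v\<close>.\<close>

lemma nonevasive_order_complex_step_half_link:
  assumes "finite Q" and "v \<in> Q" and "nonevasive (order_complex (Q - {v}))"
    and "nonevasive (order_complex (Q \<inter> {..<v})) \<or> nonevasive (order_complex (Q \<inter> {v<..}))"
  shows "nonevasive (order_complex Q)"
proof (rule nonevasive_order_complex_step)
  from assms(4) show "nonevasive (order_complex (Q \<inter> ({..<v} \<union> {v<..})))"
  proof
    assume "nonevasive (order_complex (Q \<inter> {..<v}))"
    then have "nonevasive (order_complex (Q \<inter> {v<..} \<union> Q \<inter> {..<v}))"
      using assms(1) by (intro nonevasive_order_complex_join) auto
    then show ?thesis by (simp add: Int_Un_distrib Un_commute)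
  next
    assume "nonevasive (order_complex (Q \<inter> {v<..}))"
    then have "nonevasive (order_complex (Q \<inter> {..<v} \<union> Q \<inter> {v<..}))"
      using assms(1) by (intro nonevasive_order_complex_join) auto
    then show ?thesis by (simp add: Int_Un_distrib)
  qed
qed (use assms in auto)

lemma nonevasive_order_complex_remove_half_links:
  assumes "finite Q" and "T \<subseteq> Q" and "nonevasive (order_complex T)"
    and "\<And>S. T \<subset> S \<Longrightarrow> S \<subseteq> Q \<Longrightarrow> \<exists>v\<in>S - T.
      nonevasive (order_complex (S \<inter> {..<v})) \<or> nonevasive (order_complex (S \<inter> {v<..}))"
  shows "nonevasive (order_complex Q)"
  using assms(1,2,4)
proof (induction Q rule: finite_psubset_induct)
  case (psubset Q)
  show ?case
  proof (cases "Q = T")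
    case True
    then show ?thesis using assms(3) by simp
  next
    case False
    then obtain v where v: "v \<in> Q - T"
      and half_link: "nonevasive (order_complex (Q \<inter> {..<v})) \<or> nonevasive (order_complex (Q \<inter> {v<..}))"
      using psubset.prems by blast
    have "nonevasive (order_complex (Q - {v}))"
    proof (rule psubset.IH)
      show "Q - {v} \<subset> Q" and "T \<subseteq> Q - {v}" using v psubset.prems(1) by blast+
    qed (use psubset.prems(2) in blast)
    then show ?thesis
      using nonevasive_order_complex_step_half_link v half_link psubset.hyps by blast
  qed
qed

lemma nonevasive_order_complex_remove_minimal:
  assumes "finite Q" and "T \<subseteq> Q" and "nonevasive (order_complex T)"
    and below: "\<And>z. z \<in> Q - T \<Longrightarrow> nonevasive (order_complex (T \<inter> {..<z}))"
  shows "nonevasive (order_complex Q)"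
proof (rule nonevasive_order_complex_remove_half_links[OF assms(1-3)])
  fix S assume S: "T \<subset> S" "S \<subseteq> Q"
  have "finite (S - T)" and "S - T \<noteq> {}"
    using S assms(1) by (auto intro: finite_subset)
  then obtain z where z: "z \<in> S - T" "\<And>u. u \<in> S - T \<Longrightarrow> \<not> u < z"
    using finite_has_minimal[of "S - T"] by (metis less_le)
  then have "S \<inter> {..<z} = T \<inter> {..<z}" using S by auto
  then show "\<exists>v\<in>S - T.
      nonevasive (order_complex (S \<inter> {..<v})) \<or> nonevasive (order_complex (S \<inter> {v<..}))"
    using below[of z] z(1) S(2) by (intro bexI[of _ z]) auto
qed

lemma nonevasive_order_complex_remove_maximal:
  assumes "finite Q" and "T \<subseteq> Q" and "nonevasive (order_complex T)"
    and above: "\<And>z. z \<in> Q - T \<Longrightarrow> nonevasive (order_complex (T \<inter> {z<..}))"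
  shows "nonevasive (order_complex Q)"
proof (rule nonevasive_order_complex_remove_half_links[OF assms(1-3)])
  fix S assume S: "T \<subset> S" "S \<subseteq> Q"
  have "finite (S - T)" and "S - T \<noteq> {}"
    using S assms(1) by (auto intro: finite_subset)
  then obtain z where z: "z \<in> S - T" "\<And>u. u \<in> S - T \<Longrightarrow> \<not> z < u"
    using finite_has_maximal[of "S - T"] by (metis less_le)
  then have "S \<inter> {z<..} = T \<inter> {z<..}" using S by auto
  then show "\<exists>v\<in>S - T.
      nonevasive (order_complex (S \<inter> {..<v})) \<or> nonevasive (order_complex (S \<inter> {v<..}))"
    using above[of z] z(1) S(2) by (intro bexI[of _ z]) auto
qed

lemma nonevasive_order_complex_interior_operator:
  assumes "finite Q" and closed: "\<And>z. z \<in> Q \<Longrightarrow> f z \<in> Q" and deflating: "\<And>z. z \<in> Q \<Longrightarrow> f z \<le> z"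
    and idempotent: "\<And>z. z \<in> Q \<Longrightarrow> f (f z) = f z" and mono: "mono_on Q f"
    and fixed_points: "nonevasive (order_complex {z \<in> Q. f z = z})"
  shows "nonevasive (order_complex Q)"
proof (rule nonevasive_order_complex_remove_minimal[OF assms(1) _ fixed_points])
  fix z assume z: "z \<in> Q - {z \<in> Q. f z = z}"
  show "nonevasive (order_complex ({z \<in> Q. f z = z} \<inter> {..<z}))"
  proof (rule nonevasive_order_complex_cone)
    show "finite ({z \<in> Q. f z = z} \<inter> {..<z})" using assms(1) by simp
    show "f z \<in> {z \<in> Q. f z = z} \<inter> {..<z}"
      using z closed deflating idempotent by (auto simp: less_le)
    fix u assume "u \<in> {z \<in> Q. f z = z} \<inter> {..<z}"
    then show "u \<le> f z \<or> f z \<le> u"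
      using z mono_onD[OF mono, of u z] by auto
  qed
qed blast

lemma nonevasive_order_complex_above_meet_neq:
  fixes x y b :: "'a::lattice"
  assumes "finite {y<..<b}" and "\<not> x \<le> y" and "sup x y < b"
  shows "nonevasive (order_complex {z \<in> {y<..<b}. inf x z \<noteq> inf x y})"
    (is "nonevasive (order_complex ?A)")
proof (rule nonevasive_order_complex_interior_operator)
  let ?w = "sup x y"
  show "finite ?A" by (rule finite_subset[OF _ assms(1)]) blast
  fix z assume z: "z \<in> ?A"
  have "inf x (inf z ?w) = inf x z"
    by (metis inf.commute inf.left_commute inf_sup_absorb)
  then have "inf z ?w \<noteq> y" and "inf x (inf z ?w) \<noteq> inf x y"
    using z by auto
  moreover have "y \<le> inf z ?w" using z by (simp add: less_imp_le)
  moreover have "inf z ?w < b" using z by (auto intro: le_less_trans[OF inf_le1])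
  ultimately show "inf z ?w \<in> ?A" by (simp add: less_le)
next
  let ?w = "sup x y"
  show "mono_on ?A (\<lambda>z. inf z ?w)"
    by (intro mono_onI inf_mono order_refl)
  show "nonevasive (order_complex {z \<in> ?A. inf z ?w = z})"
  proof (rule nonevasive_order_complex_cone)
    show "finite {z \<in> ?A. inf z ?w = z}"
      by (rule finite_subset[OF _ assms(1)]) blast
    have "inf x y \<noteq> x" and "y \<noteq> ?w"
      using assms(2) by (metis inf_le2, metis sup_ge1)
    then show "?w \<in> {z \<in> ?A. inf z ?w = z}"
      using assms(3) by (simp add: less_le inf_absorb1)
  qed (simp add: le_iff_inf)
qed simp_all

lemma nonevasive_order_complex_interval_noncomplements:
  fixes a b x :: "'a::lattice"
  assumes "finite {a<..<b}" and x: "x \<in> {a<..<b}"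
  shows "nonevasive (order_complex {y \<in> {a<..<b}. \<not> (inf x y = a \<and> sup x y = b)})"
    (is "nonevasive (order_complex ?Q)")
proof (rule nonevasive_order_complex_remove_maximal)
  let ?A = "\<lambda>y. {z \<in> {y<..<b}. inf x z \<noteq> inf x y}"
  have inf_sup_a: "inf x a = a" "sup x a = x"
    using x by (simp_all add: inf_absorb2 sup_absorb1 less_imp_le)
  show "finite ?Q" by (rule finite_subset[OF _ assms(1)]) blast
  show "?A a \<subseteq> ?Q" using inf_sup_a by auto
  show "nonevasive (order_complex (?A a))"
    using assms inf_sup_a by (intro nonevasive_order_complex_above_meet_neq) auto
  fix y assume "y \<in> ?Q - ?A a"
  then have y: "y \<in> {a<..<b}" "inf x y = a" "sup x y \<noteq> b"
    using inf_sup_a by auto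
  have "nonevasive (order_complex (?A y))"
  proof (rule nonevasive_order_complex_above_meet_neq)
    show "finite {y<..<b}"
      using y(1) by (intro finite_subset[OF _ assms(1)]) auto
    show "\<not> x \<le> y" using x y(2) by (auto simp: inf_absorb1)
    show "sup x y < b" using x y by (simp add: less_le)
  qed
  moreover have "?A a \<inter> {y<..} = ?A y"
    using y inf_sup_a by auto
  ultimately show "nonevasive (order_complex (?A a \<inter> {y<..}))" by simp
qed

theorem theorem2p1:
  fixes x :: "'a::{finite, bounded_lattice}" and P :: "'a set"
  assumes "x \<notin> {bot, top}"
    and "P = UNIV - complements x"
  shows "nonevasive (order_complex (P - {bot, top})) \<and>
         collapsible (order_complex (P - {bot, top}))"
proof -
  have "P - {bot, top} = {y \<in> {bot<..<top}. \<not> (inf x y = bot \<and> sup x y = top)}"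
    using assms(2) by (auto simp: complements_def bot_less less_top)
  moreover have "x \<in> {bot<..<top}"
    using assms(1) by (simp add: bot_less less_top)
  ultimately have "nonevasive (order_complex (P - {bot, top}))"
    using nonevasive_order_complex_interval_noncomplements[of bot top x] by simp
  then show ?thesis
    using nonevasive_imp_collapsible by blast
qed

end
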